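(* Let $\mathcal{I},\mathcal{J}$ be Borel ideals on $\omega$. The following are equivalent: (1) Player II has a winning strategy in $\mathfrak{G}(\mathcal{I},\mathcal{J})$; (2) Player I has a winning strategy in $\mathfrak{B}(\mathcal{I},\mathcal{J})$; (3) there is an $\mathcal{I}^+$-branching tree $T\subseteq\omega^{<\omega}$ such that $f[\omega]\in\mathcal{J}^+$ for every $f\in[T]$.
   Context: Ideals on $\omega$ are assumed to contain all finite sets; Borel refers to the topology on $\mathcal{P}(\omega)\cong 2^\omega$. $\mathcal{I}^+=\mathcal{P}(\omega)\setminus\mathcal{I}$, similarly $\mathcal{J}^+$. A tree is a nonempty $T\subseteq\omega^{<\omega}$ closed under initial segments, $[T]=\{f\in\omega^\omega: f\upharpoonright n\in T\text{ for all }n\}$, and $T$ is $\mathcal{I}^+$-branching if for every $t\in T$ the set $\{n: t^\frown\langle n\rangle\in T\}$ belongs to $\mathcal{I}^+$. The game $\mathfrak{G}(\mathcal{I},\mathcal{J})$: at round $k$, Player I plays $I_k\in\mathcal{I}$ and then Player II plays $n_k\in\omega\setminus I_k$, with $n_0<n_1<\cdots$; Player II wins iff $\{n_k:k\in\omega\}\in\mathcal{J}^+$. The game $\mathfrak{B}(\mathcal{I},\mathcal{J})$: at round $k$, Player I plays $n_k\in\omega$ with $n_0<n_1<\cdots$, then Player II plays $i_k\in\{0,1\}$; Player II wins iff $\{n_k:k\in\omega\}\in\mathcal{I}$ or $\{n_k:i_k=1\}$ is infinite and belongs to $\mathcal{J}$. *)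

theory Defs
  imports "HOL-Analysis.Analysis"
begin

definition ideal_on_nat :: "nat set set \<Rightarrow> bool" where
  "ideal_on_nat I \<longleftrightarrow>
     (\<forall>A B. A \<in> I \<longrightarrow> B \<subseteq> A \<longrightarrow> B \<in> I) \<and>
     (\<forall>A B. A \<in> I \<longrightarrow> B \<in> I \<longrightarrow> A \<union> B \<in> I) \<and>
     (\<forall>A. finite A \<longrightarrow> A \<in> I) \<and>
     UNIV \<notin> I"

text \<open>Borel, via the identification of P(omega) with Cantor space nat => bool
  (product topology of the discrete two-point space).\<close>
definition borel_ideal :: "nat set set \<Rightarrow> bool" where
  "borel_ideal I \<longleftrightarrow> (\<lambda>A. (\<lambda>n. n \<in> A)) ` I \<in> sets (borel :: (nat \<Rightarrow> bool) measure)"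

definition G_II_move :: "(nat set list \<Rightarrow> nat) \<Rightarrow> (nat \<Rightarrow> nat set) \<Rightarrow> nat \<Rightarrow> nat" where
  "G_II_move \<sigma> X k = \<sigma> (map X [0..<Suc k])"

definition II_wins_G :: "nat set set \<Rightarrow> nat set set \<Rightarrow> bool" where
  "II_wins_G I J \<longleftrightarrow> (\<exists>\<sigma>. \<forall>X. (\<forall>k. X k \<in> I) \<longrightarrow>
      (\<forall>k. G_II_move \<sigma> X k \<notin> X k) \<and>
      (\<forall>k. G_II_move \<sigma> X k < G_II_move \<sigma> X (Suc k)) \<and>
      range (G_II_move \<sigma> X) \<notin> J)"

text \<open>Game B(I,J). II's moves 0/1 are represented by False/True.
  A strategy for I maps the list of II's moves i_0..i_(k-1) to n_k.\<close>
definition B_I_move :: "(bool list \<Rightarrow> nat) \<Rightarrow> (nat \<Rightarrow> bool) \<Rightarrow> nat \<Rightarrow> nat" where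
  "B_I_move \<tau> i k = \<tau> (map i [0..<k])"

definition I_wins_B :: "nat set set \<Rightarrow> nat set set \<Rightarrow> bool" where
  "I_wins_B I J \<longleftrightarrow> (\<exists>\<tau>. \<forall>i :: nat \<Rightarrow> bool.
      (\<forall>k. B_I_move \<tau> i k < B_I_move \<tau> i (Suc k)) \<and>
      \<not> (range (B_I_move \<tau> i) \<in> I \<or>
         (infinite {B_I_move \<tau> i k | k. i k} \<and> {B_I_move \<tau> i k | k. i k} \<in> J)))"

definition is_tree :: "nat list set \<Rightarrow> bool" where
  "is_tree T \<longleftrightarrow> T \<noteq> {} \<and> (\<forall>t \<in> T. \<forall>m. take m t \<in> T)"

definition tree_body :: "nat list set \<Rightarrow> (nat \<Rightarrow> nat) set" where
  "tree_body T = {f. \<forall>n. map f [0..<n] \<in> T}"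

definition positive_branching :: "nat set set \<Rightarrow> nat list set \<Rightarrow> bool" where
  "positive_branching I T \<longleftrightarrow> (\<forall>t \<in> T. {n. t @ [n] \<in> T} \<notin> I)"

end

theory Submission
  imports Defs
begin

text \<open>
  A positive branching tree whose branches leave \<open>J\<close> is read off a winning strategy by recording
  the moves \<open>n\<^sub>k\<close> in \<open>G(I,J)\<close>, respectively those moves of I in \<open>B(I,J)\<close> that II answers by 1.
  Conversely II wins \<open>G(I,J)\<close> by moving along the tree. For \<open>B(I,J)\<close> player I also moves along the
  tree, but a branch need not be in \<open>I\<^sup>+\<close>. This is where definability enters: the Borel ideal
  \<open>I\<close> has the Baire property, hence is meager, and by the theorem of Talagrand and Jalali-Naini there is
  \<open>h\<close> such that every set containing infinitely many of the blocks \<open>{m..<h m}\<close> is positive; so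
  player I inserts such blocks between consecutive nodes.
\<close>

section \<open>Borel sets have the Baire property\<close>

text \<open>Equality with an open set modulo a meager set; the meager set is given by a countable
  family of dense open sets \<open>D n\<close> whose intersection it misses.\<close>

definition baire_property :: "'a::topological_space set \<Rightarrow> bool" where
  "baire_property S \<longleftrightarrow> (\<exists>U D. open U \<and> (\<forall>n::nat. open (D n) \<and> closure (D n) = UNIV) \<and>
     (\<forall>x. (\<forall>n. x \<in> D n) \<longrightarrow> (x \<in> S \<longleftrightarrow> x \<in> U)))"

lemma baire_property_open: "open U \<Longrightarrow> baire_property U"
  unfolding baire_property_def by (intro exI[of _ U] exI[of _ "\<lambda>_. UNIV"]) auto

text \<open>The boundary of the open set \<open>U\<close> is nowhere dense. Once its complement
  joins the dense open sets, \<open>- S\<close> agrees with the exterior of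
  \<open>U\<close>.\<close>

lemma baire_property_Compl:
  assumes "baire_property S"
  shows "baire_property (- S)"
proof -
  obtain U D where U: "open U" and D: "\<And>n::nat. open (D n) \<and> closure (D n) = UNIV"
    and S: "\<And>x. (\<forall>n. x \<in> D n) \<Longrightarrow> (x \<in> S \<longleftrightarrow> x \<in> U)"
    using assms unfolding baire_property_def by blast
  define E where "E n = (case n of 0 \<Rightarrow> U \<union> - closure U | Suc k \<Rightarrow> D k)" for n
  have "closure U \<union> closure (- closure U) = UNIV"
    using closure_subset[of "- closure U"] by auto
  then have "\<forall>n. open (E n) \<and> closure (E n) = UNIV"
    using U D by (auto simp: E_def split: nat.split)
  moreover have "x \<in> - S \<longleftrightarrow> x \<in> - closure U" if "\<forall>n. x \<in> E n" for x
  proof -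
    have "x \<in> U \<union> - closure U" using that[rule_format, of 0] by (simp add: E_def)
    moreover have "x \<in> S \<longleftrightarrow> x \<in> U"
    proof (rule S, rule allI)
      show "x \<in> D n" for n using that[rule_format, of "Suc n"] by (simp add: E_def)
    qed
    ultimately show ?thesis using closure_subset[of U] by auto
  qed
  ultimately show ?thesis
    unfolding baire_property_def by (intro exI[of _ "- closure U"] exI[of _ E]) auto
qed

lemma baire_property_UN:
  assumes "\<And>i::nat. baire_property (S i)"
  shows "baire_property (\<Union>i. S i)"
proof -
  have "\<forall>i. \<exists>U D. open U \<and> (\<forall>n::nat. open (D n) \<and> closure (D n) = UNIV) \<and>
     (\<forall>x. (\<forall>n. x \<in> D n) \<longrightarrow> (x \<in> S i \<longleftrightarrow> x \<in> U))"
    using assms unfolding baire_property_def by blast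
  then obtain U D where U: "\<And>i. open (U i)"
    and D: "\<And>i n::nat. open (D i n) \<and> closure (D i n) = UNIV"
    and S: "\<And>i x. (\<forall>n. x \<in> D i n) \<Longrightarrow> (x \<in> S i \<longleftrightarrow> x \<in> U i)"
    by metis
  \<comment> \<open>The countably many families \<open>D i\<close> are merged into one sequence by
    the pairing function.\<close>
  define E where "E n = D (fst (prod_decode n)) (snd (prod_decode n))" for n
  have "x \<in> (\<Union>i. S i) \<longleftrightarrow> x \<in> (\<Union>i. U i)" if "\<forall>n. x \<in> E n" for x
  proof -
    have "x \<in> D i n" for i n using that[rule_format, of "prod_encode (i, n)"] by (simp add: E_def)
    then have "x \<in> S i \<longleftrightarrow> x \<in> U i" for i by (intro S allI)
    then show ?thesis by simp
  qed
  moreover have "\<forall>n. open (E n) \<and> closure (E n) = UNIV" using D by (simp add: E_def)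
  ultimately show ?thesis
    unfolding baire_property_def using U by (intro exI[of _ "\<Union>i. U i"] exI[of _ E]) auto
qed

lemma baire_property_borel:
  assumes "S \<in> sets borel"
  shows "baire_property S"
proof -
  have "S \<in> sigma_sets UNIV {S. open S}" using assms by (simp add: borel_def)
  then show ?thesis
  proof induction
    case (Basic a)
    then show ?case by (simp add: baire_property_open)
  next
    case Empty
    show ?case by (simp add: baire_property_open)
  next
    case (Compl a)
    then show ?case using baire_property_Compl by (simp add: Compl_eq_Diff_UNIV)
  next
    case (Union a)
    then show ?case using baire_property_UN by blast
  qed
qed

section \<open>Cylinders and dense open sets in Cantor space\<close>

lemma open_cylinder:
  fixes x :: "nat \<Rightarrow> bool"
  shows "open {y. \<forall>i<m. y i = x i}"
proof -
  have "{y. \<forall>i<m. y i = x i} = Pi\<^sub>E UNIV (\<lambda>i. if i < m then {x i} else UNIV)"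
    by (auto simp: PiE_def Pi_def split: if_splits)
  moreover have "open (Pi\<^sub>E UNIV (\<lambda>i. if i < m then {x i} else UNIV))"
    by (rule open_PiE) (auto simp: open_discrete intro: finite_subset[of _ "{..<m}"])
  ultimately show ?thesis by simp
qed

lemma open_contains_cylinder:
  fixes x :: "nat \<Rightarrow> bool"
  assumes "open U" "x \<in> U"
  obtains m where "\<And>y. \<forall>i<m. y i = x i \<Longrightarrow> y \<in> U"
proof -
  obtain X where X: "x \<in> Pi\<^sub>E UNIV X" "finite {i. X i \<noteq> UNIV}" "Pi\<^sub>E UNIV X \<subseteq> U"
    using product_topology_open_contains_basis[of "\<lambda>_. euclidean" UNIV U x] assms
    by (auto simp: open_fun_def)
  obtain m where m: "\<forall>i\<in>{i. X i \<noteq> UNIV}. i < m"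
    using X(2) finite_nat_set_iff_bounded by blast
  have "y \<in> U" if "\<forall>i<m. y i = x i" for y
  proof -
    have "y i \<in> X i" for i using X(1) m that by (cases "X i = UNIV") (auto simp: PiE_def Pi_def)
    then show ?thesis using X(3) by (auto simp: PiE_def Pi_def)
  qed
  then show ?thesis using that by blast
qed

text \<open>There are only finitely many pairs of a prefix below \<open>m\<close> and an index
  \<open>n\<close> up to \<open>m\<close>. Treating them one at a time, density lets the pattern be
  prolonged so that the current prefix is forced into \<open>D n\<close>, and prolonging keeps what
  was forced before.\<close>

lemma dense_open_pattern:
  fixes D :: "nat \<Rightarrow> (nat \<Rightarrow> bool) set"
  assumes D: "\<And>n. open (D n) \<and> closure (D n) = UNIV"
  shows "\<exists>h p. m < h \<and> (\<forall>y. (\<forall>i. m \<le> i \<and> i < h \<longrightarrow> y i = p i) \<longrightarrow> (\<forall>n\<le>m. y \<in> D n))"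
proof -
  \<comment> \<open>The set \<open>A\<close> codes the prefix of \<open>y\<close> below
    \<open>m\<close>.\<close>
  define forces where "forces h p A n \<longleftrightarrow>
      (\<forall>y. (\<forall>i<m. y i = (i \<in> A)) \<longrightarrow> (\<forall>i. m \<le> i \<and> i < h \<longrightarrow> y i = p i) \<longrightarrow> y \<in> D n)"
    for h :: nat and p :: "nat \<Rightarrow> bool" and A :: "nat set" and n
  have step: "\<exists>h p. m < h \<and> (\<forall>q\<in>F. forces h p (fst q) (snd q))"
    if "finite F" for F :: "(nat set \<times> nat) set"
    using that
  proof induction
    case empty
    then show ?case by auto
  next
    case (insert q F)
    obtain h p where h: "m < h" and p: "\<And>q. q \<in> F \<Longrightarrow> forces h p (fst q) (snd q)"
      using insert.IH by blast
    \<comment> \<open>The prefix coded by \<open>fst q\<close> followed by the pattern so far. The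
      point \<open>z\<close> found near \<open>x\<close> serves as the longer pattern; only its
      values from \<open>m\<close> on matter.\<close>
    define x where "x i = (if i < m then i \<in> fst q else p i)" for i
    have "x \<in> {y. \<forall>i<h. y i = x i}" "closure (D (snd q)) = UNIV" using D by simp_all
    then have "{y. \<forall>i<h. y i = x i} \<inter> closure (D (snd q)) \<noteq> {}" by blast
    then have "{y. \<forall>i<h. y i = x i} \<inter> D (snd q) \<noteq> {}"
      by (simp only: open_Int_closure_eq_empty[OF open_cylinder] not_False_eq_True)
    then obtain z where z: "\<forall>i<h. z i = x i" "z \<in> D (snd q)" by blast
    obtain k where k: "\<And>y. \<forall>i<k. y i = z i \<Longrightarrow> y \<in> D (snd q)"
      using open_contains_cylinder[of "D (snd q)" z] D z(2) by blast
    have "forces (max h k) z (fst q) (snd q)"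
      unfolding forces_def
    proof (intro allI impI)
      fix y
      assume y: "\<forall>i<m. y i = (i \<in> fst q)" "\<forall>i. m \<le> i \<and> i < max h k \<longrightarrow> y i = z i"
      have "y i = z i" if "i < k" for i
        using that y z(1) h by (cases "i < m") (simp_all add: x_def)
      then show "y \<in> D (snd q)" using k by blast
    qed
    moreover have "forces (max h k) z (fst r) (snd r)" if "r \<in> F" for r
      unfolding forces_def
    proof (intro allI impI)
      fix y
      assume y: "\<forall>i<m. y i = (i \<in> fst r)" "\<forall>i. m \<le> i \<and> i < max h k \<longrightarrow> y i = z i"
      have "y i = p i" if "m \<le> i" "i < h" for i
        using y(2) z(1) that by (simp add: x_def)
      then show "y \<in> D (snd r)" using p[OF that] y(1) unfolding forces_def by blast
    qed
    ultimately have "m < max h k \<and> (\<forall>r\<in>insert q F. forces (max h k) z (fst r) (snd r))"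
      using h by auto
    then show ?case by blast
  qed
  have "finite (Pow {..<m} \<times> {..m})" by simp
  then obtain h p where h: "m < h"
    and p: "\<forall>q\<in>Pow {..<m} \<times> {..m}. forces h p (fst q) (snd q)"
    using step by blast
  have "y \<in> D n" if "\<forall>i. m \<le> i \<and> i < h \<longrightarrow> y i = p i" "n \<le> m" for y n
  proof -
    have "forces h p {i. i < m \<and> y i} n" using p[rule_format, of "({i. i < m \<and> y i}, n)"] that(2) by auto
    then show ?thesis using that(1) by (simp add: forces_def)
  qed
  then show ?thesis using h by blast
qed

section \<open>Borel ideals and blocks that force positivity\<close>

lemma ideal_on_natD:
  assumes "ideal_on_nat I"
  shows "A \<in> I \<Longrightarrow> B \<subseteq> A \<Longrightarrow> B \<in> I"
    and "A \<in> I \<Longrightarrow> B \<in> I \<Longrightarrow> A \<union> B \<in> I"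
    and "finite A \<Longrightarrow> A \<in> I"
    and "UNIV \<notin> I"
  using assms unfolding ideal_on_nat_def by metis+

lemma ideal_Int_atLeast:
  assumes I: "ideal_on_nat I" and "A \<inter> {m..} \<in> I"
  shows "A \<in> I"
proof -
  have "A \<inter> {m..} \<union> {..<m} \<in> I" using assms by (simp add: ideal_on_natD)
  then show ?thesis by (rule ideal_on_natD(1)[OF I]) auto
qed

text \<open>Points following the patterns on infinitely many blocks are generic, so for them
  membership in \<open>I\<close> is decided by the open set \<open>U\<close>. The ideal axioms force
  \<open>U\<close> to be empty; hence generic sets are positive, and a set containing infinitely
  many blocks has a generic subset.\<close>

lemma borel_ideal_large_blocks:
  assumes I: "ideal_on_nat I" and B: "borel_ideal I"
  obtains h where "\<And>X. infinite {m. {m..<h m} \<subseteq> X} \<Longrightarrow> X \<notin> I"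
proof -
  have "baire_property ((\<lambda>A n. n \<in> A) ` I)"
    using B by (intro baire_property_borel) (simp add: borel_ideal_def)
  then obtain U D where U: "open U" and D: "\<And>n::nat. open (D n) \<and> closure (D n) = UNIV"
    and "\<And>x. (\<forall>n. x \<in> D n) \<Longrightarrow> (x \<in> (\<lambda>A n. n \<in> A) ` I \<longleftrightarrow> x \<in> U)"
    unfolding baire_property_def by blast
  moreover have "x \<in> (\<lambda>A n. n \<in> A) ` I \<longleftrightarrow> {n. x n} \<in> I" for x
  proof
    assume "x \<in> (\<lambda>A n. n \<in> A) ` I"
    then show "{n. x n} \<in> I" by auto
  next
    assume "{n. x n} \<in> I"
    then show "x \<in> (\<lambda>A n. n \<in> A) ` I" by (rule rev_image_eqI) simp
  qed
  ultimately have IU: "\<And>x. (\<forall>n. x \<in> D n) \<Longrightarrow> ({n. x n} \<in> I \<longleftrightarrow> x \<in> U)" by simp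
  have "\<forall>m. \<exists>h p. m < h \<and> (\<forall>y. (\<forall>i. m \<le> i \<and> i < h \<longrightarrow> y i = p i) \<longrightarrow> (\<forall>n\<le>m. y \<in> D n))"
    by (intro allI dense_open_pattern D)
  then obtain h p where h: "\<And>m. m < h m"
    and p: "\<And>m y n. \<forall>i. m \<le> i \<and> i < h m \<longrightarrow> y i = p m i \<Longrightarrow> n \<le> m \<Longrightarrow> y \<in> D n"
    by metis
  \<comment> \<open>The pattern starting at \<open>m\<close> handles every index up to
    \<open>m\<close>, so unboundedly many starting points handle all indices.\<close>
  have generic: "y \<in> D n"
    if "infinite M" "\<And>m i. m \<in> M \<Longrightarrow> m \<le> i \<Longrightarrow> i < h m \<Longrightarrow> y i = p m i" for M y n
  proof -
    obtain m where "m \<in> M" "n \<le> m" using \<open>infinite M\<close> infinite_nat_iff_unbounded_le by blast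
    then show ?thesis using p that(2) by blast
  qed
  have empty: "U = {}"
  proof (rule ccontr)
    assume "U \<noteq> {}"
    then obtain x where "x \<in> U" by blast
    then obtain m0 where m0: "\<And>y. \<forall>i<m0. y i = x i \<Longrightarrow> y \<in> U"
      using open_contains_cylinder[OF U] by blast
    \<comment> \<open>The blocks \<open>{a k..<a (Suc k)}\<close> partition \<open>{m0..}\<close>,
      and each is of the form \<open>{m..<h m}\<close>.\<close>
    define a where "a k = (h ^^ k) m0" for k
    have a: "a k < a (Suc k)" "a (Suc k) = h (a k)" "a 0 = m0" for k by (simp_all add: a_def h)
    then have mono: "strict_mono a" by (simp add: strict_mono_Suc_iff)
    text \<open>On the blocks of one parity \<open>y c\<close> is generic, and on the others it is constantly true;
      the sets coded by \<open>y True\<close> and \<open>y False\<close> together cover a cofinite set.\<close>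
    define y where "y c i = (if i < m0 then x i else
        \<forall>k. even k = c \<and> a k \<le> i \<and> i < a (Suc k) \<longrightarrow> p (a k) i)" for c i
    have uniq: "k = l" if "a k \<le> i" "i < a (Suc k)" "a l \<le> i" "i < a (Suc l)" for k l i
    proof -
      have "k < Suc l" "l < Suc k"
        using that strict_mono_less[OF mono] by (meson le_less_trans)+
      then show ?thesis by simp
    qed
    have yI: "{n. y c n} \<in> I" for c
    proof -
      have inf: "infinite (a ` {k. even k = c})"
      proof -
        have "infinite {k::nat. even k = c}"
          unfolding infinite_nat_iff_unbounded_le
        proof
          fix m :: nat
          show "\<exists>n\<ge>m. n \<in> {k. even k = c}"
            by (cases "even m = c") (auto intro: exI[of _ m] exI[of _ "Suc m"])
        qed
        moreover have "inj_on a {k. even k = c}"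
          using strict_mono_imp_inj_on[OF mono] inj_on_subset by blast
        ultimately show ?thesis by (simp add: finite_image_iff)
      qed
      have "y c \<in> D n" for n
      proof (rule generic[OF inf])
        fix m i
        assume "m \<in> a ` {k. even k = c}" and i: "m \<le> i" "i < h m"
        then obtain k where k: "m = a k" "even k = c" by blast
        have "m0 \<le> m" using strict_mono_less_eq[OF mono, of 0 k] a(3) k(1) by simp
        then have "y c i \<longleftrightarrow> (\<forall>l. even l = c \<and> a l \<le> i \<and> i < a (Suc l) \<longrightarrow> p (a l) i)"
          using i by (simp add: y_def)
        moreover have ki: "a k \<le> i" "i < a (Suc k)" using i k(1) a(2) by simp_all
        ultimately show "y c i = p m i" using uniq[OF ki] k by blast
      qed
      moreover have "y c \<in> U" by (rule m0) (simp add: y_def)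
      ultimately show ?thesis using IU by blast
    qed
    have "UNIV \<inter> {m0..} \<subseteq> {n. y True n} \<union> {n. y False n}"
    proof
      fix i
      assume "i \<in> UNIV \<inter> {m0..}"
      then have "m0 \<le> i" by simp
      have "y True i \<or> y False i"
      proof (rule ccontr)
        assume "\<not> (y True i \<or> y False i)"
        then obtain k l where "even k" "a k \<le> i" "i < a (Suc k)" "odd l" "a l \<le> i" "i < a (Suc l)"
          using \<open>m0 \<le> i\<close> by (auto simp: y_def)
        then show False using uniq by blast
      qed
      then show "i \<in> {n. y True n} \<union> {n. y False n}" by simp
    qed
    then have "UNIV \<inter> {m0..} \<in> I"
      by (rule ideal_on_natD(1)[OF I ideal_on_natD(2)[OF I yI yI]])
    then show False using ideal_Int_atLeast[OF I] ideal_on_natD(4)[OF I] by blast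
  qed
  have "X \<notin> I" if X: "infinite {m. {m..<h m} \<subseteq> X}" for X
  proof -
    have "\<forall>b. \<exists>m\<ge>b. {m..<h m} \<subseteq> X" using X by (auto simp: infinite_nat_iff_unbounded_le)
    then obtain g where g: "\<And>b. b \<le> g b" "\<And>b. {g b..<h (g b)} \<subseteq> X" by metis
    \<comment> \<open>Starting points of blocks inside \<open>X\<close>, each chosen past the end of
      the previous block, which makes the blocks disjoint.\<close>
    define a where "a = rec_nat (g 0) (\<lambda>_ m. g (h m))"
    have aX: "{a k..<h (a k)} \<subseteq> X" for k by (cases k) (simp_all add: a_def g(2))
    have a: "h (a k) \<le> a (Suc k)" for k by (simp add: a_def g(1))
    then have mono: "strict_mono a" using h by (meson less_le_trans strict_mono_Suc_iff)
    have disj: "h (a k) \<le> a l" if "k < l" for k l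
      using that a strict_mono_less_eq[OF mono] by (meson Suc_leI le_trans)
    \<comment> \<open>The patterns are copied on the chosen blocks and the value is false elsewhere,
      so the coded set is generic and stays inside \<open>X\<close>.\<close>
    define y where "y i = (\<exists>k. a k \<le> i \<and> i < h (a k) \<and> p (a k) i)" for i
    have "y \<in> D n" for n
    proof (rule generic)
      show "infinite (range a)" using strict_mono_imp_inj_on[OF mono] finite_imageD by auto
      fix m i
      assume "m \<in> range a" "m \<le> i" "i < h m"
      then obtain k where k: "m = a k" by blast
      have "l = k" if "a l \<le> i" "i < h (a l)" for l
        using that disj[of k l] disj[of l k] \<open>m \<le> i\<close> \<open>i < h m\<close> k
        by (cases l k rule: linorder_cases) auto
      then show "y i = p m i" using k \<open>m \<le> i\<close> \<open>i < h m\<close> unfolding y_def by blast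
    qed
    then have "{n. y n} \<notin> I" using IU empty by blast
    moreover have "i \<in> X" if "y i" for i
    proof -
      obtain k where "a k \<le> i" "i < h (a k)" using \<open>y i\<close> by (auto simp: y_def)
      then show ?thesis using aX[of k] by auto
    qed
    then have "{n. y n} \<subseteq> X" by blast
    ultimately show ?thesis using ideal_on_natD(1)[OF I] by blast
  qed
  then show ?thesis using that by blast
qed

section \<open>From trees to strategies of II in \<open>G(I,J)\<close>\<close>

lemma positive_obtains:
  assumes "ideal_on_nat I" "A \<notin> I" "X \<in> I"
  obtains n where "n \<in> A" "n \<notin> X" "b \<le> n"
proof -
  have "\<not> A \<inter> {b..} \<subseteq> X"
    using assms ideal_Int_atLeast[of I A b] ideal_on_natD(1)[of I X "A \<inter> {b..}"] by blast
  then show ?thesis using that by auto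
qed

text \<open>II keeps a node of \<open>T\<close> and extends it by a successor outside the set just
  played. Positivity leaves such successors of arbitrary size, and the play becomes a
  branch.\<close>

lemma II_wins_G_if_tree:
  assumes I: "ideal_on_nat I"
    and T: "is_tree T" "positive_branching I T" "\<forall>f\<in>tree_body T. range f \<notin> J"
  shows "II_wins_G I J"
proof -
  \<comment> \<open>The sum of \<open>t\<close> bounds all its entries, so exceeding it makes the
    moves increase.\<close>
  define pick where "pick t X = (SOME n. t @ [n] \<in> T \<and> n \<notin> X \<and> sum_list t < n)" for t X
  have pick: "t @ [pick t X] \<in> T \<and> pick t X \<notin> X \<and> sum_list t < pick t X"
    if t: "t \<in> T" and X: "X \<in> I" for t X
  proof -
    have "{n. t @ [n] \<in> T} \<notin> I" using T(2) t by (simp add: positive_branching_def)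
    then obtain n where "n \<in> {n. t @ [n] \<in> T}" "n \<notin> X" "Suc (sum_list t) \<le> n"
      using positive_obtains[OF I _ X] by blast
    then have "\<exists>n. t @ [n] \<in> T \<and> n \<notin> X \<and> sum_list t < n" by auto
    then show ?thesis unfolding pick_def by (rule someI_ex)
  qed
  define step where "step t X = t @ [pick t X]" for t X
  define \<sigma> where "\<sigma> Xs = last (foldl step [] Xs)" for Xs
  have "(\<forall>k. G_II_move \<sigma> X k \<notin> X k) \<and> (\<forall>k. G_II_move \<sigma> X k < G_II_move \<sigma> X (Suc k)) \<and>
      range (G_II_move \<sigma> X) \<notin> J" if X: "\<forall>k. X k \<in> I" for X
  proof -
    define node where "node k = foldl step [] (map X [0..<k])" for k
    have node_Suc: "node (Suc k) = node k @ [pick (node k) (X k)]" for k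
      by (simp add: node_def step_def)
    have move: "G_II_move \<sigma> X k = pick (node k) (X k)" for k
    proof -
      have "G_II_move \<sigma> X k = last (node (Suc k))"
        by (simp only: G_II_move_def \<sigma>_def node_def)
      then show ?thesis by (simp add: node_Suc)
    qed
    have T_node: "node k \<in> T" for k
    proof (induction k)
      case 0
      obtain t where "t \<in> T" using T(1) by (auto simp: is_tree_def)
      then have "take 0 t \<in> T" using T(1) unfolding is_tree_def by blast
      then show ?case by (simp add: node_def)
    next
      case (Suc k)
      then show ?case using pick X by (simp add: node_Suc)
    qed
    have node: "node k = map (G_II_move \<sigma> X) [0..<k]" for k
    proof (induction k)
      case 0
      show ?case by (simp add: node_def)
    next
      case (Suc k)
      then show ?case by (simp add: move node_Suc)
    qed
    have "G_II_move \<sigma> X \<in> tree_body T"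
      using T_node by (simp add: tree_body_def node)
    moreover have "G_II_move \<sigma> X k < G_II_move \<sigma> X (Suc k)" for k
    proof -
      have "G_II_move \<sigma> X k \<le> sum_list (node (Suc k))"
        by (rule member_le_sum_list) (simp_all add: node_Suc move)
      also have "\<dots> < G_II_move \<sigma> X (Suc k)"
        using pick[of "node (Suc k)" "X (Suc k)"] X T_node by (simp add: move)
      finally show ?thesis .
    qed
    moreover have "G_II_move \<sigma> X k \<notin> X k" for k
      using pick[OF T_node] X by (simp add: move)
    ultimately show ?thesis using T(3) by blast
  qed
  then show ?thesis unfolding II_wins_G_def by blast
qed

section \<open>From winning strategies to trees\<close>

text \<open>Common to both games: \<open>S p\<close> holds the numbers that may be recorded at
  position \<open>p\<close>, and \<open>ext p n\<close> is the position after recording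
  \<open>n\<close>. Folding \<open>ext\<close> along a node recovers its position.\<close>

definition position_tree :: "('p \<Rightarrow> nat set) \<Rightarrow> ('p \<Rightarrow> nat \<Rightarrow> 'p) \<Rightarrow> 'p \<Rightarrow> nat list set" where
  "position_tree S ext p = {t. \<forall>k<length t. t ! k \<in> S (foldl ext p (take k t))}"

lemma is_tree_position_tree: "is_tree (position_tree S ext p)"
proof -
  have "[] \<in> position_tree S ext p" by (simp add: position_tree_def)
  moreover have "take m t \<in> position_tree S ext p" if "t \<in> position_tree S ext p" for t m
    using that by (simp add: position_tree_def)
  ultimately show ?thesis by (auto simp: is_tree_def)
qed

lemma position_tree_snoc:
  "t @ [n] \<in> position_tree S ext p \<longleftrightarrow> t \<in> position_tree S ext p \<and> n \<in> S (foldl ext p t)"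
proof -
  have "(\<forall>k<Suc (length t). (t @ [n]) ! k \<in> S (foldl ext p (take k (t @ [n])))) \<longleftrightarrow>
      (\<forall>k<length t. t ! k \<in> S (foldl ext p (take k t))) \<and> n \<in> S (foldl ext p t)"
    by (auto simp: All_less_Suc nth_append)
  then show ?thesis by (simp add: position_tree_def)
qed

lemma position_tree_invariant:
  assumes "t \<in> position_tree S ext p" "Q p" "\<And>p n. Q p \<Longrightarrow> n \<in> S p \<Longrightarrow> Q (ext p n)"
  shows "Q (foldl ext p t)"
  using assms(1) by (induction t rule: rev_induct) (simp_all add: assms position_tree_snoc)

text \<open>The invariant \<open>Q\<close> singles out the positions that really arise; only there
  does \<open>S\<close> have to be positive.\<close>

lemma positive_branching_position_tree:
  assumes "Q p" "\<And>p n. Q p \<Longrightarrow> n \<in> S p \<Longrightarrow> Q (ext p n)" "\<And>p. Q p \<Longrightarrow> S p \<notin> I"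
  shows "positive_branching I (position_tree S ext p)"
  unfolding positive_branching_def
proof
  fix t
  assume t: "t \<in> position_tree S ext p"
  then have "S (foldl ext p t) \<notin> I"
    using assms position_tree_invariant[of t S ext p Q] by blast
  then show "{n. t @ [n] \<in> position_tree S ext p} \<notin> I" using t by (simp add: position_tree_snoc)
qed

lemma tree_body_position_tree:
  assumes "f \<in> tree_body (position_tree S ext p)"
  shows "f k \<in> S (foldl ext p (map f [0..<k]))"
proof -
  have "map f [0..<Suc k] \<in> position_tree S ext p" using assms unfolding tree_body_def by blast
  then show ?thesis by (simp add: position_tree_snoc)
qed

text \<open>Positions are lists of moves of I, and \<open>S Xs\<close> collects the replies of II to
  one further move. If \<open>S Xs\<close> were in \<open>I\<close>, player I could play it, and the
  reply would have to lie both inside and outside it.\<close>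

lemma tree_if_II_wins_G:
  assumes I: "ideal_on_nat I" and "II_wins_G I J"
  shows "\<exists>T. is_tree T \<and> positive_branching I T \<and> (\<forall>f\<in>tree_body T. range f \<notin> J)"
proof -
  obtain \<sigma> where \<sigma>: "\<And>X. (\<forall>k. X k \<in> I) \<Longrightarrow>
      (\<forall>k. G_II_move \<sigma> X k \<notin> X k) \<and> range (G_II_move \<sigma> X) \<notin> J"
    using assms(2) unfolding II_wins_G_def by metis
  define S where "S Xs = (\<lambda>X. \<sigma> (Xs @ [X])) ` I" for Xs
  define choice where "choice Xs n = (SOME X. X \<in> I \<and> n = \<sigma> (Xs @ [X]))" for Xs n
  define ext where "ext Xs n = Xs @ [choice Xs n]" for Xs n
  have choice: "choice Xs n \<in> I \<and> n = \<sigma> (Xs @ [choice Xs n])" if "n \<in> S Xs" for Xs n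
  proof -
    have "\<exists>X. X \<in> I \<and> n = \<sigma> (Xs @ [X])" using that by (auto simp: S_def)
    then show ?thesis unfolding choice_def by (rule someI_ex)
  qed
  have "S Xs \<notin> I" if Xs: "set Xs \<subseteq> I" for Xs
  proof
    assume S: "S Xs \<in> I"
    \<comment> \<open>After \<open>Xs\<close> and the move \<open>S Xs\<close>, player I continues
      with the legal default \<open>{}\<close>.\<close>
    define X where "X k = (if k < Suc (length Xs) then (Xs @ [S Xs]) ! k else {})" for k
    have "{} \<in> I" using ideal_on_natD(3)[OF I] by simp
    moreover have "(Xs @ [S Xs]) ! k \<in> I" if "k < Suc (length Xs)" for k
    proof -
      have "(Xs @ [S Xs]) ! k \<in> set (Xs @ [S Xs])" by (rule nth_mem) (use that in simp)
      then show ?thesis using Xs S by auto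
    qed
    ultimately have X: "\<forall>k. X k \<in> I" by (simp add: X_def)
    have "map X [0..<Suc (length Xs)] = Xs @ [S Xs]"
      by (rule nth_equalityI) (auto simp: X_def simp del: upt_Suc)
    then have "G_II_move \<sigma> X (length Xs) = \<sigma> (Xs @ [S Xs])" by (simp only: G_II_move_def)
    moreover have "G_II_move \<sigma> X (length Xs) \<notin> X (length Xs)" using \<sigma>[OF X] by blast
    moreover have "X (length Xs) = S Xs" by (simp add: X_def)
    moreover have "\<sigma> (Xs @ [S Xs]) \<in> S Xs" using S unfolding S_def[of Xs] by (rule imageI)
    ultimately show False by simp
  qed
  then have positive: "positive_branching I (position_tree S ext [])"
    using choice by (intro positive_branching_position_tree[where Q = "\<lambda>Xs. set Xs \<subseteq> I"])
      (simp_all add: ext_def)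
  have branch: "range f \<notin> J" if f: "f \<in> tree_body (position_tree S ext [])" for f
  proof -
    define pos where "pos k = foldl ext [] (map f [0..<k])" for k
    define X where "X k = choice (pos k) (f k)" for k
    have X: "X k \<in> I" "f k = \<sigma> (pos k @ [X k])" for k
      using choice[OF tree_body_position_tree[OF f, of k]] by (simp_all add: X_def pos_def)
    have pos: "pos k = map X [0..<k]" for k
    proof (induction k)
      case 0
      show ?case by (simp add: pos_def)
    next
      case (Suc k)
      have "pos (Suc k) = pos k @ [X k]" by (simp add: pos_def ext_def X_def)
      then show ?case using Suc by simp
    qed
    \<comment> \<open>The chosen moves of I form one play against \<open>\<sigma>\<close>, and the
      replies in it are exactly the branch.\<close>
    have "G_II_move \<sigma> X = f" using X(2) by (auto simp: G_II_move_def pos)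
    then show ?thesis using \<sigma>[of X] X(1) by simp
  qed
  show ?thesis
    by (intro exI[of _ "position_tree S ext []"] conjI ballI is_tree_position_tree positive branch)
qed

text \<open>A position is coded by the finite set \<open>P\<close> of rounds at which II has answered 1. Recording
  only the moves of I that are answered by 1 yields a tree all of whose branches lie outside \<open>J\<close>,
  and letting II answer only 0 from \<open>P\<close> on shows that the successor sets are positive.\<close>

lemma tree_if_I_wins_B:
  assumes I: "ideal_on_nat I" and "I_wins_B I J"
  shows "\<exists>T. is_tree T \<and> positive_branching I T \<and> (\<forall>f\<in>tree_body T. range f \<notin> J)"
proof -
  from assms(2)[unfolded I_wins_B_def] obtain \<tau> where "\<forall>i :: nat \<Rightarrow> bool.
      (\<forall>k. B_I_move \<tau> i k < B_I_move \<tau> i (Suc k)) \<and>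
      \<not> (range (B_I_move \<tau> i) \<in> I \<or>
         (infinite {B_I_move \<tau> i k | k. i k} \<and> {B_I_move \<tau> i k | k. i k} \<in> J))"
    by (rule exE)
  note \<tau> = this[THEN spec]
  \<comment> \<open>The moves of I when II answers 1 exactly at the rounds in
    \<open>P\<close>.\<close>
  define B where "B P = B_I_move \<tau> (\<lambda>k. k \<in> P)" for P
  have B_cong: "B P k = B P' k" if "\<And>m. m < k \<Longrightarrow> m \<in> P \<longleftrightarrow> m \<in> P'" for P P' k
    using that by (auto simp: B_def B_I_move_def intro!: arg_cong[of _ _ \<tau>])
  define S where "S P = {B P j | j. \<forall>m\<in>P. m < j}" for P
  define choice where "choice P n = (SOME j. n = B P j \<and> (\<forall>m\<in>P. m < j))" for P n
  define ext where "ext P n = insert (choice P n) P" for P n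
  have choice: "n = B P (choice P n) \<and> (\<forall>m\<in>P. m < choice P n)" if "n \<in> S P" for P n
  proof -
    have "\<exists>j. n = B P j \<and> (\<forall>m\<in>P. m < j)" using that by (auto simp: S_def)
    then show ?thesis unfolding choice_def by (rule someI_ex)
  qed
  have "S P \<notin> I" if P: "finite P" for P
  proof
    assume S: "S P \<in> I"
    obtain b where b: "\<forall>m\<in>P. m < b" using P finite_nat_set_iff_bounded by blast
    \<comment> \<open>All but finitely many moves of the run \<open>B P\<close> belong to
      \<open>S P\<close>.\<close>
    have "B P k \<in> S P \<union> B P ` {..<b}" for k
      using b by (cases "k < b") (auto simp: S_def intro!: exI[of _ k])
    then have "range (B P) \<subseteq> S P \<union> B P ` {..<b}" by blast
    moreover have "S P \<union> B P ` {..<b} \<in> I" using S I by (simp add: ideal_on_natD)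
    ultimately have "range (B P) \<in> I" using ideal_on_natD(1)[OF I] by blast
    then show False using \<tau>[of "\<lambda>k. k \<in> P"] by (simp add: B_def)
  qed
  then have positive: "positive_branching I (position_tree S ext {})"
    by (intro positive_branching_position_tree[where Q = finite]) (simp_all add: ext_def)
  have branch: "range f \<notin> J" if f: "f \<in> tree_body (position_tree S ext {})" for f
  proof -
    define pos where "pos k = foldl ext {} (map f [0..<k])" for k
    define j where "j k = choice (pos k) (f k)" for k
    have j: "f k = B (pos k) (j k)" "\<forall>m\<in>pos k. m < j k" for k
      using choice[OF tree_body_position_tree[OF f, of k]] by (simp_all add: j_def pos_def)
    have pos: "pos k = j ` {..<k}" for k
    proof (induction k)
      case 0
      show ?case by (simp add: pos_def)
    next
      case (Suc k)
      have "pos (Suc k) = insert (j k) (pos k)" by (simp add: pos_def ext_def j_def)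
      then show ?case using Suc by (simp add: lessThan_Suc)
    qed
    have mono: "strict_mono j" using j(2) by (auto simp: strict_mono_def pos)
    \<comment> \<open>As \<open>j\<close> increases, \<open>pos k\<close> and \<open>range j\<close>
      agree below round \<open>j k\<close>, so all recorded moves occur in the single run
      \<open>B (range j)\<close>.\<close>
    have f_eq: "f k = B (range j) (j k)" for k
      unfolding j(1) using strict_mono_less[OF mono] by (intro B_cong) (auto simp: pos)
    have "strict_mono (B (range j))"
      using \<tau>[of "\<lambda>k. k \<in> range j"] by (simp add: strict_mono_Suc_iff B_def)
    then have "strict_mono f" using mono by (simp add: strict_mono_def f_eq)
    then have "inj f" by (rule strict_mono_imp_inj_on)
    then have "infinite (range f)" using finite_imageD by blast
    moreover have "{B (range j) k | k. k \<in> range j} = range f" by (auto simp: f_eq)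
    ultimately show ?thesis using \<tau>[of "\<lambda>k. k \<in> range j"] by (simp add: B_def)
  qed
  show ?thesis
    by (intro exI[of _ "position_tree S ext {}"] conjI ballI is_tree_position_tree positive branch)
qed

section \<open>From trees to strategies of I in \<open>B(I,J)\<close>\<close>

text \<open>Both lists are strictly increasing with the same elements. With \<open>K\<close> the
  rounds at which the node grows, this identifies the nodes reached with initial segments of a
  branch.\<close>

lemma filter_upt_enumerate:
  assumes "infinite K"
  shows "filter (\<lambda>k. k \<in> K) [0..<enumerate K j] = map (enumerate K) [0..<j]"
proof (rule strict_sorted_equal)
  show "sorted_wrt (<) (map (enumerate K) [0..<j])"
    using assms by (simp add: sorted_wrt_map)
  show "sorted_wrt (<) (filter (\<lambda>k. k \<in> K) [0..<enumerate K j])"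
    by (simp add: sorted_wrt_filter)
  show "set (filter (\<lambda>k. k \<in> K) [0..<enumerate K j]) = set (map (enumerate K) [0..<j])"
  proof
    show "set (map (enumerate K) [0..<j]) \<subseteq> set (filter (\<lambda>k. k \<in> K) [0..<enumerate K j])"
      using assms by (auto simp: enumerate_in_set)
    show "set (filter (\<lambda>k. k \<in> K) [0..<enumerate K j]) \<subseteq> set (map (enumerate K) [0..<j])"
    proof
      fix k
      assume k: "k \<in> set (filter (\<lambda>k. k \<in> K) [0..<enumerate K j])"
      then obtain l where "enumerate K l = k" using enumerate_Ex[OF assms, of k] by auto
      then show "k \<in> set (map (enumerate K) [0..<j])" using k assms by auto
    qed
  qed
qed

text \<open>Player I walks along \<open>T\<close>, passing to the successor node \<open>t @ [n]\<close> whenever an offered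
  successor \<open>n\<close> of \<open>t\<close> is answered by 1, and then plays a whole block \<open>{m..<h m}\<close> ignoring the
  answers. Infinitely many blocks make the set of moves positive; without them I
  enumerates almost all successors of one node. In a state \<open>(t, m, e)\<close> all later moves are at least
  \<open>m\<close>, and a block is being played as long as \<open>m < e\<close>.\<close>

lemma I_wins_B_if_tree:
  assumes I: "ideal_on_nat I" and J: "ideal_on_nat J" and "borel_ideal I"
    and T: "is_tree T" "positive_branching I T" "\<forall>f\<in>tree_body T. range f \<notin> J"
  shows "I_wins_B I J"
proof -
  obtain h where h: "\<And>X. infinite {m. {m..<h m} \<subseteq> X} \<Longrightarrow> X \<notin> I"
    using borel_ideal_large_blocks[OF I \<open>borel_ideal I\<close>] by blast
  define move where "move = (\<lambda>(t, m, e). if m < e then m else LEAST n. t @ [n] \<in> T \<and> m \<le> n)"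
  \<comment> \<open>An answer 1 counts only when no block is running; the new block then starts
    right after the accepted successor.\<close>
  define step where "step = (\<lambda>(t, m, e) b. if b \<and> e \<le> m
      then (t @ [move (t, m, e)], Suc (move (t, m, e)), h (Suc (move (t, m, e))))
      else (t, Suc (move (t, m, e)), e))"
  define \<tau> where "\<tau> bs = move (foldl step ([], 0, 0) bs)" for bs
  have win: "(\<forall>k. B_I_move \<tau> i k < B_I_move \<tau> i (Suc k)) \<and>
      \<not> (range (B_I_move \<tau> i) \<in> I \<or>
         (infinite {B_I_move \<tau> i k | k. i k} \<and> {B_I_move \<tau> i k | k. i k} \<in> J))" for i
  proof -
    define state where "state k = foldl step ([], 0, 0) (map i [0..<k])" for k
    define t where "t k = fst (state k)" for k
    define m where "m k = fst (snd (state k))" for k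
    define e where "e k = snd (snd (state k))" for k
    define n where "n = B_I_move \<tau> i"
    \<comment> \<open>The rounds at which the node grows.\<close>
    define K where "K = {k. i k \<and> e k \<le> m k}"
    have state: "state k = (t k, m k, e k)" for k by (simp add: t_def m_def e_def)
    have n_state: "n k = move (t k, m k, e k)" for k
      unfolding state[symmetric] by (simp add: n_def B_I_move_def \<tau>_def state_def)
    have n_eq: "n k = (if m k < e k then m k else LEAST x. t k @ [x] \<in> T \<and> m k \<le> x)" for k
      by (simp add: n_state move_def)
    have "state (Suc k) = step (state k) (i k)" for k by (simp add: state_def)
    then have state_Suc: "state (Suc k) = (if k \<in> K then (t k @ [n k], Suc (n k), h (Suc (n k)))
        else (t k, Suc (n k), e k))" for k
      by (simp add: state step_def n_state K_def)
    have m_Suc: "m (Suc k) = Suc (n k)" for k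
      using state_Suc[of k] by (simp add: state split: if_splits)
    have t_Suc: "t (Suc k) = (if k \<in> K then t k @ [n k] else t k)" for k
      using state_Suc[of k] by (simp add: state split: if_splits)
    have e_Suc: "e (Suc k) = (if k \<in> K then h (m (Suc k)) else e k)" for k
      using state_Suc[of k] by (simp add: state m_Suc split: if_splits)
    have t_0: "t 0 = []" by (simp add: t_def state_def)
    have least: "t k @ [n k] \<in> T \<and> m k \<le> n k" if "t k \<in> T" "e k \<le> m k" for k
    proof -
      have "{x. t k @ [x] \<in> T} \<notin> I" using T(2) that(1) by (simp add: positive_branching_def)
      moreover have "{} \<in> I" using ideal_on_natD(3)[OF I] by simp
      ultimately obtain x where "x \<in> {x. t k @ [x] \<in> T}" "m k \<le> x"
        using positive_obtains[OF I] by blast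
      then have "\<exists>x. t k @ [x] \<in> T \<and> m k \<le> x" by auto
      then have "t k @ [LEAST x. t k @ [x] \<in> T \<and> m k \<le> x] \<in> T \<and>
          m k \<le> (LEAST x. t k @ [x] \<in> T \<and> m k \<le> x)" by (rule LeastI_ex)
      then show ?thesis using that(2) by (simp add: n_eq)
    qed
    have tT: "t k \<in> T" for k
    proof (induction k)
      case 0
      obtain s where "s \<in> T" using T(1) by (auto simp: is_tree_def)
      then have "take 0 s \<in> T" using T(1) unfolding is_tree_def by blast
      then show ?case by (simp add: t_0)
    next
      case (Suc k)
      then show ?case using least by (simp add: t_Suc K_def)
    qed
    have m_le: "m k \<le> n k" for k
      using least[OF tT, of k] by (cases "m k < e k") (simp_all add: n_eq)
    have "m k < m (Suc k)" for k using m_le[of k] by (simp add: m_Suc)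
    then have mono: "strict_mono m" by (simp add: strict_mono_Suc_iff)
    have "n k < n (Suc k)" for k using m_le[of "Suc k"] by (simp add: m_Suc)
    moreover have "range n \<notin> I \<and> (infinite {n k | k. i k} \<longrightarrow> {n k | k. i k} \<notin> J)"
    proof (cases "finite K")
      case True
      then have "\<exists>k0. \<forall>k\<in>K. k < k0" by (simp only: finite_nat_set_iff_bounded)
      then obtain k0 where k0: "\<And>k. k \<in> K \<Longrightarrow> k < k0" by blast
      have const: "t k = t k0 \<and> e k = e k0" if "k0 \<le> k" for k
        using that
      proof (induction k rule: dec_induct)
        case (step k)
        then have "k \<notin> K" using k0[of k] by auto
        then show ?case using step by (simp add: t_Suc e_Suc)
      qed simp
      \<comment> \<open>Since \<open>k \<le> m k\<close>, from round \<open>k1\<close> on the last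
        block is over, the node is fixed, and an answer 1 would put the round into
        \<open>K\<close>.\<close>
      define k1 where "k1 = max k0 (e k0)"
      have late: "e k \<le> m k" "t k = t k0" "k \<notin> K" if "k1 \<le> k" for k
        using const[of k] that strict_mono_imp_increasing[OF mono, of k] k0[of k]
        by (auto simp: k1_def)
      have "{x. t k0 @ [x] \<in> T} \<inter> {m k1..} \<subseteq> range n"
      proof (rule subsetI, rule ccontr)
        fix x
        assume x: "x \<in> {x. t k0 @ [x] \<in> T} \<inter> {m k1..}" and "x \<notin> range n"
        \<comment> \<open>A skipped successor \<open>x\<close> would remain a candidate for the
          least choice, keeping every later \<open>m k\<close> below or at \<open>x\<close>,
          although \<open>m\<close> is unbounded.\<close>
        have "m k \<le> x" if "k1 \<le> k" for k
          using that
        proof (induction k rule: dec_induct)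
          case base
          then show ?case using x by simp
        next
          case (step k)
          have "n k \<le> x"
            using late(1,2)[OF \<open>k1 \<le> k\<close>] step.IH x by (simp add: n_eq Least_le)
          moreover have "n k \<noteq> x" using \<open>x \<notin> range n\<close> by blast
          ultimately show ?case by (simp add: m_Suc)
        qed
        then have "m (k1 + Suc x) \<le> x" by simp
        then show False using strict_mono_imp_increasing[OF mono, of "k1 + Suc x"] by simp
      qed
      moreover have "{x. t k0 @ [x] \<in> T} \<inter> {m k1..} \<notin> I"
        using T(2) tT[of k0] ideal_Int_atLeast[OF I] unfolding positive_branching_def by blast
      ultimately have "range n \<notin> I" using ideal_on_natD(1)[OF I] by blast
      moreover have "{n k | k. i k} \<subseteq> n ` {..<k1}"
      proof
        fix x
        assume "x \<in> {n k | k. i k}"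
        then obtain k where k: "x = n k" "i k" by blast
        then have "k < k1" using late(1,3)[of k] by (cases "k1 \<le> k") (simp_all add: K_def)
        then show "x \<in> n ` {..<k1}" using k(1) by simp
      qed
      then have "finite {n k | k. i k}" by (rule finite_subset) simp
      ultimately show ?thesis by simp
    next
      case False
      \<comment> \<open>While a block runs, \<open>m\<close> advances by one each round and
        \<open>e\<close> stays put. The bound allows equality, which describes the state just after
        the last block move.\<close>
      have block: "m (Suc k) + d \<le> e (Suc k) \<longrightarrow>
          m (Suc k + d) = m (Suc k) + d \<and> e (Suc k + d) = e (Suc k)" for k d
      proof (induction d)
        case (Suc d)
        show ?case
        proof
          assume "m (Suc k) + Suc d \<le> e (Suc k)"
          then have d: "m (Suc k + d) = m (Suc k) + d" "e (Suc k + d) = e (Suc k)"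
            "m (Suc k + d) < e (Suc k + d)"
            using Suc by simp_all
          then have "Suc k + d \<notin> K" "n (Suc k + d) = m (Suc k + d)" by (simp_all add: K_def n_eq)
          then show "m (Suc k + Suc d) = m (Suc k) + Suc d \<and> e (Suc k + Suc d) = e (Suc k)"
            using d m_Suc[of "Suc k + d"] e_Suc[of "Suc k + d"] by simp
        qed
      qed simp
      have "{m (Suc k)..<h (m (Suc k))} \<subseteq> range n" if "k \<in> K" for k
      proof
        fix x
        assume x: "x \<in> {m (Suc k)..<h (m (Suc k))}"
        define d where "d = x - m (Suc k)"
        have d: "x = m (Suc k) + d" "x < e (Suc k)"
          using x that by (simp_all add: d_def e_Suc)
        then have "n (Suc k + d) = x" using block[of k d] by (simp add: n_eq)
        then show "x \<in> range n" by blast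
      qed
      then have "(\<lambda>k. m (Suc k)) ` K \<subseteq> {m. {m..<h m} \<subseteq> range n}" by blast
      moreover have "infinite ((\<lambda>k. m (Suc k)) ` K)"
      proof -
        have "inj_on (\<lambda>k. m (Suc k)) K"
          using strict_mono_eq[OF mono] by (auto simp: inj_on_def)
        then show ?thesis using False finite_imageD by blast
      qed
      ultimately have "range n \<notin> I" using h finite_subset by blast
      moreover have "{n k | k. i k} \<notin> J"
      proof
        assume ones: "{n k | k. i k} \<in> J"
        have t: "t k = map n (filter (\<lambda>k. k \<in> K) [0..<k])" for k
          by (induction k) (simp_all add: t_0 t_Suc)
        have "map (n \<circ> enumerate K) [0..<j] = t (enumerate K j)" for j
          by (simp add: t filter_upt_enumerate[OF False])
        \<comment> \<open>The accepted successors form a branch. Block moves answered by 1 only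
          enlarge the set of moves answered by 1, so that set is outside \<open>J\<close> as
          well.\<close>
        then have "n \<circ> enumerate K \<in> tree_body T" using tT by (simp add: tree_body_def)
        then have "range (n \<circ> enumerate K) \<notin> J" using T(3) by blast
        moreover have "range (n \<circ> enumerate K) \<subseteq> {n k | k. i k}"
          using enumerate_in_set[OF False] by (auto simp: K_def)
        ultimately show False using ideal_on_natD(1)[OF J ones] by blast
      qed
      ultimately show ?thesis by simp
    qed
    ultimately show ?thesis unfolding n_def by blast
  qed
  show ?thesis unfolding I_wins_B_def by (intro exI[of _ \<tau>] allI win)
qed

text \<open>Each game is compared with the tree condition, which then links the two games.\<close>

theorem mainTheorem18:
  fixes I J :: "nat set set"
  assumes "ideal_on_nat I" and "ideal_on_nat J"
    and "borel_ideal I" and "borel_ideal J"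
  shows "(II_wins_G I J \<longleftrightarrow> I_wins_B I J) \<and>
         (I_wins_B I J \<longleftrightarrow>
            (\<exists>T. is_tree T \<and> positive_branching I T \<and>
                 (\<forall>f \<in> tree_body T. range f \<notin> J)))"
proof -
  let ?tree = "\<exists>T. is_tree T \<and> positive_branching I T \<and> (\<forall>f \<in> tree_body T. range f \<notin> J)"
  have "II_wins_G I J \<longleftrightarrow> ?tree"
    using II_wins_G_if_tree[OF assms(1)] tree_if_II_wins_G[OF assms(1)] by auto
  moreover have "I_wins_B I J \<longleftrightarrow> ?tree"
    using I_wins_B_if_tree[OF assms(1-3)] tree_if_I_wins_B[OF assms(1)] by auto
  ultimately show ?thesis by simp
qed

end
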